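(* Let $x,z\in\mathbb{R}^n$ with $x>0$, $z>0$ componentwise, let $A\in\mathbb{R}^{m\times n}$ with $m\le n$, and let $\Theta=\mathrm{diag}(x_1/z_1,\dots,x_n/z_n)$. Let $\mathcal N\subseteq\{1,\dots,n\}$ and $\delta_d$ be as in the context, and set $$M=\begin{bmatrix} -\Theta^{-1} & A^T \\ A & 0 \end{bmatrix},\qquad E=\begin{bmatrix} 0 & 0 \\ 0 & \delta_d I_m \end{bmatrix}.$$ Let $\lambda_i$ and $\tilde\lambda_i$ be the respective $i$-th smallest eigenvalues of $M$ and $M+E$, and define $$\phi_i=\frac{\|A\|}{\sqrt{(|\lambda_i|-2\|E\|)^2+\|A\|^2}}.$$ Then for every $i$ such that $|\lambda_i|>2\|E\|$, and such that for every $t\in[0,1]$ the $i$-th smallest eigenvalue $\lambda_i(t)$ of $M+tE$ is simple, we have $$|\lambda_i-\tilde\lambda_i|\le\|E\|\,\phi_i^2 .$$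
   Context: $\|\cdot\|$ is the Euclidean norm on vectors and the induced spectral norm on matrices; $\|\cdot\|_\infty$ is the induced matrix $\infty$-norm (maximum absolute row sum). $\mathcal N$ is a nonempty set of column indices satisfying $\max_{j\in\mathcal N}(\Theta)_{jj}\,\|AA^T\|_\infty\le \mathrm{reg}_{thr}$ for a given threshold $\mathrm{reg}_{thr}>0$. $A_{\mathcal N}$ is the submatrix of $A$ formed by the columns with indices in $\mathcal N$, and $\Theta_{\mathcal N}$ is the corresponding diagonal submatrix of $\Theta$. The scalar $\delta_d$ is $\delta_d=\big(\max_j(\Theta_{\mathcal N})_{jj}\big)\,\|A_{\mathcal N}A_{\mathcal N}^T\|_\infty$. Eigenvalues of the (real symmetric) matrices are ordered increasingly with multiplicity; an eigenvalue is simple if its algebraic multiplicity is 1. *)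

theory Defs
  imports
    "HOL-Analysis.Analysis"
    "HOL-Computational_Algebra.Polynomial"
begin

definition diag_matrix :: "'a::zero ^ 'n \<Rightarrow> 'a ^ 'n ^ 'n" where
  "diag_matrix d = (\<chi> i j. if i = j then d $ i else 0)"

text \<open>The block matrix with rows \<open>(P, Q)\<close> and \<open>(R, S)\<close>; the sum type indexes the rows
  and columns of the two diagonal blocks.\<close>

definition block_matrix ::
  "'a ^ 'n ^ 'n \<Rightarrow> 'a ^ 'm ^ 'n \<Rightarrow> 'a ^ 'n ^ 'm \<Rightarrow> 'a ^ 'm ^ 'm \<Rightarrow> 'a ^ ('n + 'm) ^ ('n + 'm)" where
  "block_matrix P Q R S = (\<chi> r c.
     (case r of
        Inl i \<Rightarrow> (case c of Inl j \<Rightarrow> P $ i $ j | Inr l \<Rightarrow> Q $ i $ l)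
      | Inr k \<Rightarrow> (case c of Inl j \<Rightarrow> R $ k $ j | Inr l \<Rightarrow> S $ k $ l)))"

definition spectral_norm :: "real ^ 'n ^ 'm \<Rightarrow> real" where
  "spectral_norm A = onorm (\<lambda>v. A *v v)"

definition row_sum_norm :: "real ^ 'n ^ 'm \<Rightarrow> real" where
  "row_sum_norm A = (MAX i. \<Sum>j\<in>UNIV. \<bar>A $ i $ j\<bar>)"

text \<open>The product \<open>A\<^sub>N A\<^sub>N\<^sup>T\<close>, where \<open>A\<^sub>N\<close> consists of the columns of \<open>A\<close> with index in \<open>N\<close>.
  The product is written entrywise because \<open>A\<^sub>N\<close> itself has column indices ranging over a set
  and not over a type.\<close>

definition column_gram :: "'n set \<Rightarrow> real ^ 'n ^ 'm \<Rightarrow> real ^ 'm ^ 'm" where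
  "column_gram N A = (\<chi> i k. \<Sum>j\<in>N. A $ i $ j * A $ k $ j)"

text \<open>\<open>delta\<^sub>d = (max\<^sub>j (\<Theta>\<^sub>N)\<^sub>j\<^sub>j) \<parallel>A\<^sub>N A\<^sub>N\<^sup>T\<parallel>\<^sub>\<infinity>\<close>. \<open>Max\<close> is only meaningful for nonempty \<open>N\<close>.\<close>

definition delta_d :: "'n::finite set \<Rightarrow> real ^ 'n ^ 'n \<Rightarrow> real ^ 'n ^ 'm \<Rightarrow> real" where
  "delta_d N \<Theta> A = (MAX j\<in>N. \<Theta> $ j $ j) * row_sum_norm (column_gram N A)"

definition charpoly :: "'a::comm_ring_1 ^ 'n ^ 'n \<Rightarrow> 'a poly" where
  "charpoly A = det (mat [:0, 1:] - map_matrix (\<lambda>a. [:a:]) A)"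

text \<open>The real eigenvalues in increasing order, repeated according to algebraic multiplicity.
  For a symmetric matrix all roots of the characteristic polynomial are real, so the list
  has length \<open>CARD('n)\<close>. The index \<open>i\<close> of \<open>eigenvalue i A\<close> starts at 1; its value is meaningful
  only for \<open>i\<close> between 1 and the length of the list.\<close>

definition eigenvalues :: "real ^ 'n ^ 'n \<Rightarrow> real list" where
  "eigenvalues A = sorted_list_of_multiset (proots (charpoly A))"

definition eigenvalue :: "nat \<Rightarrow> real ^ 'n ^ 'n \<Rightarrow> real" where
  "eigenvalue i A = eigenvalues A ! (i - 1)"

definition simple_eigenvalue :: "real ^ 'n ^ 'n \<Rightarrow> real \<Rightarrow> bool" where
  "simple_eigenvalue A l \<longleftrightarrow> order l (charpoly A) = 1"

end

theory Submission
  imports Defs "HOL-Computational_Algebra.Fundamental_Theorem_Algebra"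
begin

text \<open>Write \<open>f t\<close> for the \<open>i\<close>-th eigenvalue of \<open>M + t E\<close>. Every limit of difference
  quotients of \<open>f\<close> at \<open>t\<close> is a Rayleigh quotient \<open>w \<bullet> E w\<close> of a unit eigenvector
  \<open>w = (u, v)\<close>, here \<open>\<delta>\<^sub>d \<parallel>v\<parallel>\<^sup>2\<close>. Bounding it by \<open>\<parallel>E\<parallel>\<close> gives
  Weyl's inequality along the line, hence \<open>\<bar>f t - t \<delta>\<^sub>d\<bar> \<ge> \<bar>\<lambda>\<^sub>i\<bar> - 2 \<parallel>E\<parallel>\<close>. The lower block row
  \<open>A u = (f t - t \<delta>\<^sub>d) v\<close> together with \<open>\<parallel>u\<parallel>\<^sup>2 + \<parallel>v\<parallel>\<^sup>2 = 1\<close> then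
  gives \<open>\<parallel>v\<parallel>\<^sup>2 \<le> \<phi>\<^sub>i\<^sup>2\<close>, and integrating the sharper bound over \<open>[0, 1]\<close> is the claim.\<close>

section \<open>Characteristic polynomials of real symmetric matrices\<close>

text \<open>By the Leibniz formula a determinant is a polynomial in the entries with integer
  coefficients. The maps in question are evaluation at a point and the embedding of the reals into
  the complex numbers.\<close>

lemma det_map_matrix_hom:
  fixes h :: "'a::comm_ring_1 \<Rightarrow> 'b::comm_ring_1" and A :: "'a ^ 'n ^ 'n"
  assumes add: "\<And>x y. h (x + y) = h x + h y"
    and mult: "\<And>x y. h (x * y) = h x * h y"
    and one: "h 1 = 1"
  shows "det (map_matrix h A) = h (det A)"
proof -
  have zero: "h 0 = 0"
    using add[of 0 0] by simp
  have uminus: "h (- x) = - h x" for x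
    using add[of x "- x"] zero by (simp add: eq_neg_iff_add_eq_0 add.commute)
  have sum: "h (sum f S) = (\<Sum>x\<in>S. h (f x))" for f :: "('n \<Rightarrow> 'n) \<Rightarrow> 'a" and S
    by (induction S rule: infinite_finite_induct) (auto simp: zero add)
  have prod: "h (prod f S) = (\<Prod>x\<in>S. h (f x))" for f :: "'n \<Rightarrow> 'a" and S
    by (induction S rule: infinite_finite_induct) (auto simp: one mult)
  have sign: "h (of_int (sign p)) = of_int (sign p)" for p :: "'n \<Rightarrow> 'n"
    by (simp add: sign_def one uminus)
  show ?thesis
    unfolding det_def by (simp add: sum mult prod sign)
qed

lemma poly_charpoly:
  fixes A :: "'a::comm_ring_1 ^ 'n ^ 'n"
  shows "poly (charpoly A) x = det (mat x - A)"
proof -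
  have "poly (charpoly A) x = det (map_matrix (\<lambda>p. poly p x) (mat [:0, 1:] - map_matrix (\<lambda>a. [:a:]) A))"
    unfolding charpoly_def by (subst det_map_matrix_hom) auto
  also have "map_matrix (\<lambda>p. poly p x) (mat [:0, 1:] - map_matrix (\<lambda>a. [:a:]) A) = mat x - A"
    by (simp add: vec_eq_iff mat_def)
  finally show ?thesis .
qed

text \<open>In the Leibniz sum the identity contributes the monic product \<open>q\<close>. Any
  other permutation moves some index, so one of its factors is constant and its term has lower
  degree.\<close>

lemma charpoly_monic:
  fixes A :: "'a::idom ^ 'n ^ 'n"
  shows "degree (charpoly A) = CARD('n)" and "lead_coeff (charpoly A) = 1"
proof -
  define B where "B = mat [:0, 1:] - map_matrix (\<lambda>a. [:a:]) A"
  define f where "f p = of_int (sign p) * (\<Prod>i\<in>UNIV. B $ i $ p i)" for p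
  define q where "q = (\<Prod>i\<in>UNIV. [:- (A $ i $ i), 1:])"
  have B: "B $ i $ j = (if i = j then [:- (A $ i $ j), 1:] else [:- (A $ i $ j):])" for i j
    by (simp add: B_def mat_def)
  have "charpoly A = (\<Sum>p | p permutes UNIV. f p)"
    by (simp add: charpoly_def det_def f_def B_def)
  also have "\<dots> = f id + (\<Sum>p\<in>{p. p permutes UNIV} - {id}. f p)"
    by (subst sum.remove[where x = id]) (auto simp: permutes_id)
  also have "f id = q"
    by (simp add: f_def q_def B)
  finally have eq: "charpoly A = q + (\<Sum>p\<in>{p. p permutes UNIV} - {id}. f p)" .
  have deg_q: "degree q = CARD('n)"
    unfolding q_def by (subst degree_prod_sum_eq) auto
  have lead_q: "lead_coeff q = 1"
    unfolding q_def by (subst lead_coeff_prod) simp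
  have "degree (f p) < CARD('n)" if "p \<noteq> id" for p
  proof -
    from that obtain i where i: "p i \<noteq> i"
      by (auto simp: fun_eq_iff)
    have "degree (f p) \<le> degree (\<Prod>i\<in>UNIV. B $ i $ p i)"
      by (simp add: f_def sign_def)
    also have "\<dots> \<le> (\<Sum>i\<in>UNIV. degree (B $ i $ p i))"
      using degree_prod_sum_le[of UNIV "\<lambda>i. B $ i $ p i"] by (simp add: o_def)
    also have "\<dots> = (\<Sum>i\<in>UNIV. if p i = i then 1 else 0)"
      by (intro sum.cong) (auto simp: B)
    also have "\<dots> < (\<Sum>i\<in>(UNIV::'n set). 1)"
      by (rule sum_strict_mono_ex1) (use i in auto)
    finally show ?thesis
      by simp
  qed
  then have less: "degree (\<Sum>p\<in>{p. p permutes UNIV} - {id}. f p) < degree q"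
    unfolding deg_q by (intro degree_sum_less) auto
  show "degree (charpoly A) = CARD('n)"
    unfolding eq using less deg_q by (simp add: degree_add_eq_left)
  show "lead_coeff (charpoly A) = 1"
    unfolding eq using less lead_q by (simp add: degree_add_eq_left coeff_eq_0)
qed

lemma det_eq_0_imp_eigenvector:
  fixes A :: "'a::field ^ 'n ^ 'n"
  assumes "det (mat l - A) = 0"
  obtains v where "v \<noteq> 0" "A *v v = l *s v"
proof -
  have "\<not> invertible (mat l - A)"
    using assms by (simp add: invertible_det_nz)
  then obtain v where v: "v \<noteq> 0" "(mat l - A) *v v = 0"
    using invertible_left_inverse matrix_left_invertible_ker by blast
  have "mat l *v v = l *s v"
    by (simp add: vec_eq_iff matrix_vector_mult_def mat_def if_distrib if_distribR cong: if_cong)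
  with v that show ?thesis
    by (simp add: matrix_vector_mult_diff_rdistrib)
qed

text \<open>The Hermitian form of \<open>A\<close> at an eigenvector \<open>v\<close> is
  \<open>l * S\<close>, with \<open>S\<close> the squared norm of \<open>v\<close>. Real symmetric
  entries make the form its own conjugate, and \<open>S\<close> is real and nonzero.\<close>

lemma cnj_root_of_symmetric:
  fixes A :: "real ^ 'n ^ 'n"
  assumes sym: "transpose A = A"
    and root: "det (mat l - map_matrix complex_of_real A) = 0"
  shows "cnj l = l"
proof -
  obtain v where v: "v \<noteq> 0" "map_matrix complex_of_real A *v v = l *s v"
    using det_eq_0_imp_eigenvector[OF root] .
  have eig: "(\<Sum>j\<in>UNIV. of_real (A $ i $ j) * v $ j) = l * v $ i" for i
    using arg_cong[OF v(2), of "\<lambda>w. w $ i"] by (simp add: matrix_vector_mult_def)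
  define S where "S = (\<Sum>i\<in>UNIV. v $ i * cnj (v $ i))"
  have S_real: "S = of_real (\<Sum>i\<in>UNIV. (cmod (v $ i))\<^sup>2)"
    unfolding S_def of_real_sum by (intro sum.cong refl) (simp only: complex_norm_square)
  have A_sym: "A $ i $ j = A $ j $ i" for i j
    using arg_cong[OF sym, of "\<lambda>B. B $ j $ i"] by (simp add: transpose_def)
  have "l * S = (\<Sum>i\<in>UNIV. cnj (v $ i) * (l * v $ i))"
    by (simp add: S_def sum_distrib_left mult_ac)
  also have "\<dots> = (\<Sum>i\<in>UNIV. \<Sum>j\<in>UNIV. of_real (A $ i $ j) * cnj (v $ i) * v $ j)"
    by (simp add: eig[symmetric] sum_distrib_left mult_ac)
  finally have l: "l * S = (\<Sum>i\<in>UNIV. \<Sum>j\<in>UNIV. of_real (A $ i $ j) * cnj (v $ i) * v $ j)" .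
  have "cnj (l * S) = (\<Sum>i\<in>UNIV. \<Sum>j\<in>UNIV. of_real (A $ i $ j) * v $ i * cnj (v $ j))"
    unfolding l by simp
  also have "\<dots> = l * S"
    unfolding l by (subst sum.swap) (simp add: A_sym mult_ac)
  finally have "cnj l * S = l * S"
    by (simp add: S_real)
  moreover have "S \<noteq> 0"
  proof
    assume "S = 0"
    then have "(\<Sum>i\<in>UNIV. (cmod (v $ i))\<^sup>2) = 0"
      unfolding S_real of_real_eq_0_iff .
    then have "\<forall>i. v $ i = 0"
      by (subst (asm) sum_nonneg_eq_0_iff) auto
    with v(1) show False
      by (simp add: vec_eq_iff)
  qed
  ultimately show ?thesis
    by simp
qed

section \<open>Real factorization and the sorted list of eigenvalues\<close>

lemma proots_prod_linear: "proots (\<Prod>x\<leftarrow>xs. [:- x, 1:]) = mset xs"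
proof (induction xs)
  case (Cons a xs)
  have "(\<Prod>x\<leftarrow>xs. [:- x, 1:]) \<noteq> 0"
    by (auto simp: prod_list_zero_iff)
  then have "proots ([:- a, 1:] * (\<Prod>x\<leftarrow>xs. [:- x, 1:])) = {#a#} + mset xs"
    by (subst proots_mult) (simp_all add: Cons.IH)
  then show ?case
    by simp
qed simp

lemma poly_prod_linear_eq_0: "x \<in> set xs \<Longrightarrow> poly (\<Prod>x\<leftarrow>xs. [:- x, 1:]) x = 0"
  for x :: "'a::comm_ring_1"
  by (induction xs) auto

lemma eigenvalues_eqI:
  assumes "charpoly A = (\<Prod>x\<leftarrow>xs. [:- x, 1:])" "sorted xs"
  shows "eigenvalues A = xs"
  using assms by (simp add: eigenvalues_def proots_prod_linear sorted_sort_id)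

lemma sorted_eigenvalues: "sorted (eigenvalues A)"
  by (simp add: eigenvalues_def)

text \<open>The fundamental theorem of algebra splits the polynomial over the complex numbers; all
  roots are real by \<open>cnj_root_of_symmetric\<close>, so the splitting descends. The length
  ensures that list access below \<open>CARD('n)\<close> yields a genuine eigenvalue.\<close>

lemma charpoly_symmetric:
  fixes A :: "real ^ 'n ^ 'n"
  assumes sym: "transpose A = A"
  shows "charpoly A = (\<Prod>x\<leftarrow>eigenvalues A. [:- x, 1:])"
    and "length (eigenvalues A) = CARD('n)"
proof -
  define P where "P = charpoly (map_matrix complex_of_real A)"
  obtain rs where rs: "mset rs = proots P"
    using ex_mset by blast
  have "P = smult (lead_coeff P) (\<Prod>x\<in>#proots P. [:- x, 1:])"
    by (rule complex_poly_decompose_multiset[symmetric])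
  also have "\<dots> = (\<Prod>x\<leftarrow>rs. [:- x, 1:])"
    unfolding prod_mset_prod_list[symmetric] mset_map rs P_def charpoly_monic(2) by simp
  finally have P: "P = (\<Prod>x\<leftarrow>rs. [:- x, 1:])" .
  have "P \<noteq> 0"
    using charpoly_monic(2)[of "map_matrix complex_of_real A"] by (auto simp: P_def)
  have len: "length rs = CARD('n)"
    using arg_cong[OF rs, of size] by (simp add: size_proots_complex P_def charpoly_monic)
  have real: "of_real (Re x) = x" if "x \<in> set rs" for x
  proof -
    have "x \<in># proots P"
      using that by (metis rs set_mset_mset)
    then have "poly P x = 0"
      using \<open>P \<noteq> 0\<close> by simp
    then have "cnj x = x"
      using cnj_root_of_symmetric[OF sym] by (simp add: P_def poly_charpoly)
    then show ?thesis
      by (metis Reals_cnj_iff of_real_Re)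
  qed
  define xs where "xs = sort (map Re rs)"
  have "poly (charpoly A) x = poly (\<Prod>x\<leftarrow>map Re rs. [:- x, 1:]) x" for x
  proof -
    have "complex_of_real (poly (charpoly A) x) = det (map_matrix of_real (mat x - A))"
      unfolding poly_charpoly by (subst det_map_matrix_hom) auto
    also have "map_matrix of_real (mat x - A) = mat (of_real x) - map_matrix complex_of_real A"
      by (simp add: vec_eq_iff mat_def)
    also have "det \<dots> = poly (\<Prod>x\<leftarrow>rs. [:- x, 1:]) (of_real x)"
      unfolding P[symmetric] by (simp add: P_def poly_charpoly)
    also have "\<dots> = of_real (poly (\<Prod>x\<leftarrow>map Re rs. [:- x, 1:]) x)"
      using real by (induction rs) auto
    finally show ?thesis
      by (simp only: of_real_eq_iff)
  qed
  then have "charpoly A = (\<Prod>x\<leftarrow>map Re rs. [:- x, 1:])"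
    unfolding poly_eq_poly_eq_iff[symmetric] by (rule ext)
  \<comment> \<open>Sorting only permutes the factors, so the products are compared through
    multisets.\<close>
  also have "\<dots> = (\<Prod>x\<leftarrow>xs. [:- x, 1:])"
    unfolding xs_def prod_mset_prod_list[symmetric] by (simp add: image_mset.compositionality)
  finally have eq: "charpoly A = (\<Prod>x\<leftarrow>xs. [:- x, 1:])" .
  moreover have "eigenvalues A = xs"
    by (rule eigenvalues_eqI[OF eq]) (simp add: xs_def)
  ultimately show "charpoly A = (\<Prod>x\<leftarrow>eigenvalues A. [:- x, 1:])"
    and "length (eigenvalues A) = CARD('n)"
    by (simp_all add: xs_def len)
qed

lemma eigenvector_symmetric:
  fixes A :: "real ^ 'n ^ 'n"
  assumes sym: "transpose A = A" and k: "k < CARD('n)"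
  obtains v where "norm v = 1" "A *v v = (eigenvalues A ! k) *\<^sub>R v"
proof -
  let ?l = "eigenvalues A ! k"
  have "?l \<in> set (eigenvalues A)"
    using k charpoly_symmetric(2)[OF sym] by simp
  then have "poly (charpoly A) ?l = 0"
    by (subst charpoly_symmetric(1)[OF sym]) (rule poly_prod_linear_eq_0)
  then obtain v where v: "v \<noteq> 0" "A *v v = ?l *\<^sub>R v"
    using det_eq_0_imp_eigenvector by (metis poly_charpoly scalar_mult_eq_scaleR)
  show ?thesis
  proof (rule that)
    show "norm (v /\<^sub>R norm v) = 1"
      using v by simp
    show "A *v (v /\<^sub>R norm v) = ?l *\<^sub>R (v /\<^sub>R norm v)"
      by (simp add: matrix_vector_mult_scaleR v)
  qed
qed

section \<open>Eigenvalues along a line of symmetric matrices\<close>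

lemma tendsto_det:
  fixes B :: "'a \<Rightarrow> real ^ 'n ^ 'n"
  assumes "(B \<longlongrightarrow> L) F"
  shows "((\<lambda>x. det (B x)) \<longlongrightarrow> det L) F"
  unfolding det_def by (intro tendsto_intros assms)

lemma tendsto_matrix_vector_mult:
  fixes B :: "'a \<Rightarrow> real ^ 'n ^ 'm"
  assumes "(B \<longlongrightarrow> L) F" "(u \<longlongrightarrow> v) F"
  shows "((\<lambda>x. B x *v u x) \<longlongrightarrow> L *v v) F"
  unfolding matrix_vector_mult_def by (intro tendsto_vec_lambda tendsto_intros assms)

lemma symmetric_inner:
  fixes A :: "real ^ 'n ^ 'n"
  assumes "transpose A = A"
  shows "v \<bullet> (A *v u) = (A *v v) \<bullet> u"
  using dot_lmul_matrix[of v A u] vector_transpose_matrix[of v A] assms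
  by (metis matrix_vector_mul_lid transpose_matrix_vector)

text \<open>Each induction step thins the subsequence found so far to make one more sequence
  converge; thinning keeps the limits already obtained.\<close>

lemma compact_convergent_subseq_upto:
  fixes X :: "nat \<Rightarrow> nat \<Rightarrow> 'a::metric_space"
  assumes S: "compact S" and X: "\<And>n k. k < N \<Longrightarrow> X n k \<in> S"
  shows "\<exists>r l. strict_mono r \<and> (\<forall>k<N. l k \<in> S \<and> (\<lambda>n. X (r n) k) \<longlonglongrightarrow> l k)"
  using X
proof (induction N)
  case 0
  show ?case
    using strict_mono_id by auto
next
  case (Suc N)
  then obtain r l where r: "strict_mono r"
    and l: "\<And>k. k < N \<Longrightarrow> l k \<in> S \<and> (\<lambda>n. X (r n) k) \<longlonglongrightarrow> l k"
    by (metis less_Suc_eq)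
  have "\<forall>n. X (r n) N \<in> S"
    using Suc.prems by simp
  with S obtain y s where s: "strict_mono s" and y: "y \<in> S" "((\<lambda>n. X (r n) N) \<circ> s) \<longlonglongrightarrow> y"
    unfolding compact_def by metis
  have "(l(N := y)) k \<in> S \<and> (\<lambda>n. X ((r \<circ> s) n) k) \<longlonglongrightarrow> (l(N := y)) k" if "k < Suc N" for k
  proof (cases "k = N")
    case True
    with y show ?thesis
      by (simp add: o_def)
  next
    case False
    with that have "k < N"
      by simp
    with l[of k] LIMSEQ_subseq_LIMSEQ[OF _ s, of "\<lambda>n. X (r n) k" "l k"] show ?thesis
      by (simp add: o_def)
  qed
  moreover have "strict_mono (r \<circ> s)"
    using r s by (rule strict_mono_o)
  ultimately show ?case
    by blast
qed

text \<open>Numbering the factors by list position allows limits to be taken factor by factor, one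
  eigenvalue index at a time.\<close>

lemma poly_prod_linear: "poly (\<Prod>x\<leftarrow>xs. [:- x, 1:]) y = (\<Prod>k<length xs. y - xs ! k)"
  for y :: "'a::comm_ring_1"
proof -
  have "poly (\<Prod>x\<leftarrow>xs. [:- x, 1:]) y = (\<Prod>x\<leftarrow>xs. y - x)"
    by (induction xs) (auto simp: algebra_simps)
  also have "\<dots> = (\<Prod>k<length xs. y - xs ! k)"
    by (subst prod.list_conv_set_nth) (simp add: atLeast0LessThan)
  finally show ?thesis .
qed

text \<open>Compactness replaces a Weyl-type continuity theorem: unit eigenvectors for all indices
  converge along a common subsequence, the eigenvalues converge with them as Rayleigh quotients, and
  passing to the limit in the factorized characteristic polynomial identifies the limits, which are
  still sorted, as the eigenvalues of the limit matrix.\<close>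

lemma eigenpair_convergent_subseq:
  fixes B :: "nat \<Rightarrow> real ^ 'n ^ 'n"
  assumes sym: "\<And>n. transpose (B n) = B n" and lim: "B \<longlonglongrightarrow> L" and k: "k < CARD('n)"
  obtains r u v where
    "strict_mono r"
    "\<And>n. B (r n) *v u n = (eigenvalues (B (r n)) ! k) *\<^sub>R u n"
    "u \<longlonglongrightarrow> v" "norm v = 1" "L *v v = (eigenvalues L ! k) *\<^sub>R v"
proof -
  let ?ev = "\<lambda>n k. eigenvalues (B n) ! k"
  have "\<forall>n k. \<exists>v. k < CARD('n) \<longrightarrow> norm v = 1 \<and> B n *v v = ?ev n k *\<^sub>R v"
    using eigenvector_symmetric[OF sym] by blast
  then obtain W where W: "\<And>n k. k < CARD('n) \<Longrightarrow> norm (W n k) = 1"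
      "\<And>n k. k < CARD('n) \<Longrightarrow> B n *v W n k = ?ev n k *\<^sub>R W n k"
    unfolding choice_iff by blast
  have "\<exists>r w. strict_mono r \<and> (\<forall>k<CARD('n). w k \<in> sphere 0 1 \<and> (\<lambda>n. W (r n) k) \<longlonglongrightarrow> w k)"
    using W(1) by (intro compact_convergent_subseq_upto) auto
  then obtain r w where r: "strict_mono r"
    and w: "\<And>k. k < CARD('n) \<Longrightarrow> w k \<in> sphere 0 1"
      "\<And>k. k < CARD('n) \<Longrightarrow> (\<lambda>n. W (r n) k) \<longlonglongrightarrow> w k"
    by blast
  have Br: "(\<lambda>n. B (r n)) \<longlonglongrightarrow> L"
    using LIMSEQ_subseq_LIMSEQ[OF lim r] by (simp add: o_def)
  define e where "e j = w j \<bullet> (L *v w j)" for j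
  have ev: "(\<lambda>n. ?ev (r n) j) \<longlonglongrightarrow> e j" if j: "j < CARD('n)" for j
  proof -
    have "(\<lambda>n. W (r n) j \<bullet> (B (r n) *v W (r n) j)) \<longlonglongrightarrow> e j"
      unfolding e_def by (intro tendsto_inner tendsto_matrix_vector_mult w Br j)
    also have "(\<lambda>n. W (r n) j \<bullet> (B (r n) *v W (r n) j)) = (\<lambda>n. ?ev (r n) j)"
      using W[OF j] by (simp add: dot_square_norm)
    finally show ?thesis .
  qed
  define xs where "xs = map e [0..<CARD('n)]"
  have "sorted xs"
  proof -
    have "e i \<le> e j" if "i \<le> j" "j < CARD('n)" for i j
    proof (rule LIMSEQ_le[OF ev ev])
      show "\<exists>N. \<forall>n\<ge>N. ?ev (r n) i \<le> ?ev (r n) j"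
        using that sorted_nth_mono[OF sorted_eigenvalues] charpoly_symmetric(2)[OF sym] by metis
    qed (use that in auto)
    then show ?thesis
      by (auto simp: xs_def sorted_iff_nth_mono)
  qed
  moreover have "charpoly L = (\<Prod>x\<leftarrow>xs. [:- x, 1:])"
    unfolding poly_eq_poly_eq_iff[symmetric]
  proof (rule ext)
    fix y
    have "(\<lambda>n. det (mat y - B (r n))) \<longlonglongrightarrow> det (mat y - L)"
      by (intro tendsto_det tendsto_diff tendsto_const Br)
    moreover have "det (mat y - B (r n)) = (\<Prod>k<CARD('n). y - ?ev (r n) k)" for n
      using poly_prod_linear[of "eigenvalues (B (r n))" y] charpoly_symmetric[OF sym, of "r n"]
      by (simp only: poly_charpoly[symmetric])
    moreover have "(\<lambda>n. \<Prod>k<CARD('n). y - ?ev (r n) k) \<longlonglongrightarrow> (\<Prod>k<CARD('n). y - e k)"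
      by (intro tendsto_prod tendsto_diff tendsto_const ev) simp
    ultimately have "det (mat y - L) = (\<Prod>k<CARD('n). y - e k)"
      by (metis (no_types, lifting) LIMSEQ_unique ext)
    then show "poly (charpoly L) y = poly (\<Prod>x\<leftarrow>xs. [:- x, 1:]) y"
      unfolding poly_charpoly poly_prod_linear by (simp add: xs_def)
  qed
  ultimately have "eigenvalues L = xs"
    by (intro eigenvalues_eqI)
  then have L_ev: "eigenvalues L ! k = e k"
    using k by (simp add: xs_def)
  show ?thesis
  proof (rule that[OF r, of "\<lambda>n. W (r n) k" "w k"])
    have "(\<lambda>n. B (r n) *v W (r n) k) \<longlonglongrightarrow> L *v w k"
      by (intro tendsto_matrix_vector_mult Br w k)
    moreover have "(\<lambda>n. B (r n) *v W (r n) k) \<longlonglongrightarrow> e k *\<^sub>R w k"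
      unfolding W(2)[OF k] by (intro tendsto_scaleR ev w k)
    ultimately show "L *v w k = (eigenvalues L ! k) *\<^sub>R w k"
      unfolding L_ev by (rule LIMSEQ_unique)
  qed (use W w k in auto)
qed

text \<open>If \<open>w\<^sub>t\<close>, \<open>w\<^sub>x\<close> are eigenvectors of \<open>M + t E\<close>, \<open>M + x E\<close> for \<open>f t\<close>, \<open>f x\<close>, symmetry gives
  \<open>(f t - f x) (w\<^sub>x \<bullet> w\<^sub>t) = (t - x) (w\<^sub>x \<bullet> E w\<^sub>t)\<close>. Choosing \<open>w\<^sub>x\<close> as a limit of \<open>w\<^sub>t\<close>
  bounds the difference quotients also at multiple eigenvalues.\<close>

lemma eigenvalue_line_bound:
  fixes M E :: "real ^ 'n ^ 'n" and k :: nat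
  defines "f \<equiv> \<lambda>t. eigenvalues (M + t *\<^sub>R E) ! k"
  assumes M: "transpose M = M" and E: "transpose E = E" and k: "k < CARD('n)" and "a \<le> b"
    and bound: "\<And>t w. \<lbrakk>a \<le> t; t \<le> b; norm w = 1; (M + t *\<^sub>R E) *v w = f t *\<^sub>R w\<rbrakk>
      \<Longrightarrow> \<bar>w \<bullet> (E *v w)\<bar> \<le> K"
  shows "\<bar>f b - f a\<bar> \<le> K * (b - a)"
proof -
  have sym: "transpose (M + t *\<^sub>R E) = M + t *\<^sub>R E" for t
    using M E by (simp add: transpose_def vec_eq_iff)
  have ident: "(f t - f x) * (v \<bullet> u) = (t - x) * (v \<bullet> (E *v u))"
    if "(M + t *\<^sub>R E) *v u = f t *\<^sub>R u" "(M + x *\<^sub>R E) *v v = f x *\<^sub>R v" for t x u v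
  proof -
    have "v \<bullet> ((M + t *\<^sub>R E) *v u) = v \<bullet> ((M + x *\<^sub>R E) *v u) + (t - x) * (v \<bullet> (E *v u))"
      by (simp add: matrix_vector_mult_add_rdistrib scaleR_matrix_vector_assoc[symmetric]
          inner_add_right algebra_simps)
    then show ?thesis
      unfolding symmetric_inner[OF sym] that by (simp add: algebra_simps that symmetric_inner[OF sym])
  qed
  \<comment> \<open>Near \<open>x\<close> the slope of \<open>f\<close> is at most
    \<open>K + \<epsilon>\<close>. Failure at every scale \<open>1 / (n + 1)\<close> would give a
    sequence tending to \<open>x\<close>, and the slack \<open>\<epsilon>\<close> survives in the
    limit as a contradiction.\<close>
  have local: "\<exists>d>0. \<forall>t. a \<le> t \<and> t \<le> b \<and> \<bar>t - x\<bar> < d \<longrightarrow> \<bar>f t - f x\<bar> \<le> (K + \<epsilon>) * \<bar>t - x\<bar>"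
    if x: "a \<le> x" "x \<le> b" and \<epsilon>: "\<epsilon> > 0" for x \<epsilon>
  proof (rule ccontr)
    assume "\<not> ?thesis"
    then have "\<exists>t. a \<le> t \<and> t \<le> b \<and> \<bar>t - x\<bar> < inverse (real (Suc n)) \<and> \<bar>f t - f x\<bar> > (K + \<epsilon>) * \<bar>t - x\<bar>" for n
      by (metis not_le inverse_positive_iff_positive of_nat_0_less_iff zero_less_Suc)
    then obtain t where t: "\<And>n. a \<le> t n" "\<And>n. t n \<le> b"
      "\<And>n. \<bar>t n - x\<bar> < inverse (real (Suc n))" "\<And>n. \<bar>f (t n) - f x\<bar> > (K + \<epsilon>) * \<bar>t n - x\<bar>"
      by metis
    have "(\<lambda>n. t n - x) \<longlonglongrightarrow> 0"
      by (rule Lim_null_comparison[OF _ LIMSEQ_inverse_real_of_nat]) (intro always_eventually allI, use t(3) in \<open>simp add: less_imp_le\<close>)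
    then have "t \<longlonglongrightarrow> x"
      by (simp add: LIM_zero_iff)
    then have "(\<lambda>n. M + t n *\<^sub>R E) \<longlonglongrightarrow> M + x *\<^sub>R E"
      by (intro tendsto_intros)
    then obtain r u v where ruv: "strict_mono r"
      "\<And>n. (M + t (r n) *\<^sub>R E) *v u n = f (t (r n)) *\<^sub>R u n"
      "u \<longlonglongrightarrow> v" "norm v = 1" "(M + x *\<^sub>R E) *v v = f x *\<^sub>R v"
      using eigenpair_convergent_subseq[of "\<lambda>n. M + t n *\<^sub>R E", OF sym _ k] unfolding f_def
      by (metis (no_types, lifting))
    have "(K + \<epsilon>) * \<bar>v \<bullet> u n\<bar> \<le> \<bar>v \<bullet> (E *v u n)\<bar>" for n
    proof -
      \<comment> \<open>The failing inequality is strict, but at \<open>t (r n) = x\<close> both of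
        its sides vanish.\<close>
      have "t (r n) \<noteq> x"
        using t(4)[of "r n"] by auto
      moreover have "(K + \<epsilon>) * \<bar>t (r n) - x\<bar> * \<bar>v \<bullet> u n\<bar> \<le> \<bar>f (t (r n)) - f x\<bar> * \<bar>v \<bullet> u n\<bar>"
        using t(4)[of "r n"] by (intro mult_right_mono) auto
      moreover have "\<bar>f (t (r n)) - f x\<bar> * \<bar>v \<bullet> u n\<bar> = \<bar>t (r n) - x\<bar> * \<bar>v \<bullet> (E *v u n)\<bar>"
        using ident[OF ruv(2,5)] by (simp add: abs_mult[symmetric])
      ultimately have "\<bar>t (r n) - x\<bar> * ((K + \<epsilon>) * \<bar>v \<bullet> u n\<bar>) \<le> \<bar>t (r n) - x\<bar> * \<bar>v \<bullet> (E *v u n)\<bar>"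
        by (simp add: mult_ac)
      with \<open>t (r n) \<noteq> x\<close> show ?thesis
        by simp
    qed
    moreover have "(\<lambda>n. (K + \<epsilon>) * \<bar>v \<bullet> u n\<bar>) \<longlonglongrightarrow> (K + \<epsilon>) * \<bar>v \<bullet> v\<bar>"
      by (intro tendsto_intros ruv)
    moreover have "(\<lambda>n. \<bar>v \<bullet> (E *v u n)\<bar>) \<longlonglongrightarrow> \<bar>v \<bullet> (E *v v)\<bar>"
      by (intro tendsto_rabs tendsto_inner tendsto_matrix_vector_mult tendsto_const ruv)
    \<comment> \<open>As \<open>v\<close> is a unit vector, the left side is
      \<open>\<bar>K + \<epsilon>\<bar>\<close> without the outer bars, that is
      \<open>K + \<epsilon>\<close>, while \<open>bound\<close> at \<open>x\<close> caps the right
      side by \<open>K\<close>.\<close>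
    ultimately have "(K + \<epsilon>) * \<bar>v \<bullet> v\<bar> \<le> \<bar>v \<bullet> (E *v v)\<bar>"
      using LIMSEQ_le by blast
    also have "\<dots> \<le> K"
      using bound[OF x ruv(4,5)] .
    finally show False
      using \<epsilon> ruv(4) by (simp add: dot_square_norm)
  qed
  have "\<bar>f b - f a\<bar> \<le> (K + \<epsilon>) * (b - a)" if \<epsilon>: "\<epsilon> > 0" for \<epsilon>
  proof -
    \<comment> \<open>Bisection globalizes the local bounds: the estimate adds up over adjacent
      intervals and holds on short intervals around each point. The guards in \<open>P\<close>
      confine it to subintervals of \<open>[a, b]\<close>, where \<open>local\<close>
      applies.\<close>
    have "a \<le> a \<and> b \<le> b \<longrightarrow> \<bar>f b - f a\<bar> \<le> (K + \<epsilon>) * (b - a)"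
      using \<open>a \<le> b\<close>
    proof (rule Bolzano[where P = "\<lambda>c d. a \<le> c \<and> d \<le> b \<longrightarrow> \<bar>f d - f c\<bar> \<le> (K + \<epsilon>) * (d - c)"])
      fix x y z
      assume "a \<le> x \<and> y \<le> b \<longrightarrow> \<bar>f y - f x\<bar> \<le> (K + \<epsilon>) * (y - x)"
        "a \<le> y \<and> z \<le> b \<longrightarrow> \<bar>f z - f y\<bar> \<le> (K + \<epsilon>) * (z - y)" "x \<le> y" "y \<le> z"
      then show "a \<le> x \<and> z \<le> b \<longrightarrow> \<bar>f z - f x\<bar> \<le> (K + \<epsilon>) * (z - x)"
        by (auto simp: algebra_simps)
    next
      fix x
      assume "a \<le> x" "x \<le> b"
      from local[OF this \<epsilon>] obtain d where "d > 0"
        and d: "\<And>t. \<lbrakk>a \<le> t; t \<le> b; \<bar>t - x\<bar> < d\<rbrakk> \<Longrightarrow> \<bar>f t - f x\<bar> \<le> (K + \<epsilon>) * \<bar>t - x\<bar>"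
        by blast
      have "\<bar>f z - f y\<bar> \<le> (K + \<epsilon>) * (z - y)"
        if "y \<le> x" "x \<le> z" "z - y < d" "a \<le> y" "z \<le> b" for y z
      proof -
        have "\<bar>f y - f x\<bar> \<le> (K + \<epsilon>) * (x - y)" "\<bar>f z - f x\<bar> \<le> (K + \<epsilon>) * (z - x)"
          using d[of y] d[of z] that by auto
        then show ?thesis
          by (auto simp: algebra_simps)
      qed
      with \<open>d > 0\<close> show "\<exists>d>0. \<forall>y z. y \<le> x \<and> x \<le> z \<and> z - y < d \<longrightarrow>
          (a \<le> y \<and> z \<le> b \<longrightarrow> \<bar>f z - f y\<bar> \<le> (K + \<epsilon>) * (z - y))"
        by blast
    qed
    then show ?thesis
      by simp
  qed
  then have *: "\<bar>f b - f a\<bar> \<le> K * (b - a) + \<epsilon> * (b - a)" if "\<epsilon> > 0" for \<epsilon>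
    using that by (metis distrib_right)
  show ?thesis
  \<comment> \<open>The slack is removed by taking \<open>\<epsilon> / (b - a)\<close>, which
    requires a nondegenerate interval.\<close>
  proof (cases "a = b")
    case False
    show ?thesis
    proof (rule field_le_epsilon)
      fix \<epsilon> :: real
      assume "\<epsilon> > 0"
      with *[of "\<epsilon> / (b - a)"] False \<open>a \<le> b\<close> show "\<bar>f b - f a\<bar> \<le> K * (b - a) + \<epsilon>"
        by simp
    qed
  qed simp
qed

section \<open>The block matrices\<close>

lemma sum_UNIV_Plus: "(\<Sum>c\<in>UNIV. g c) = (\<Sum>j\<in>UNIV. g (Inl j)) + (\<Sum>l\<in>UNIV. g (Inr l))"
  for g :: "'n::finite + 'm::finite \<Rightarrow> 'b::comm_monoid_add"
  by (subst UNIV_Plus_UNIV[symmetric], subst sum.Plus) (simp_all add: o_def)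

definition upper :: "'a ^ ('n::finite + 'm::finite) \<Rightarrow> 'a ^ 'n" where
  "upper w = (\<chi> j. w $ Inl j)"

definition lower :: "'a ^ ('n::finite + 'm::finite) \<Rightarrow> 'a ^ 'm" where
  "lower w = (\<chi> l. w $ Inr l)"

lemma inner_upper_lower: "v \<bullet> w = upper v \<bullet> upper w + lower v \<bullet> lower w"
  for v w :: "real ^ ('n::finite + 'm::finite)"
  by (simp add: inner_vec_def sum_UNIV_Plus upper_def lower_def)

lemma norm_upper_lower: "(norm w)\<^sup>2 = (norm (upper w))\<^sup>2 + (norm (lower w))\<^sup>2"
  for w :: "real ^ ('n::finite + 'm::finite)"
  by (simp add: power2_norm_eq_inner inner_upper_lower)

lemma upper_block_matrix:
  "upper (block_matrix P Q R S *v w) = P *v upper w + Q *v lower w"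
  by (simp add: vec_eq_iff upper_def lower_def block_matrix_def matrix_vector_mult_def sum_UNIV_Plus)

lemma lower_block_matrix:
  "lower (block_matrix P Q R S *v w) = R *v upper w + S *v lower w"
  by (simp add: vec_eq_iff upper_def lower_def block_matrix_def matrix_vector_mult_def sum_UNIV_Plus)

lemma transpose_block_matrix:
  "transpose (block_matrix P Q R S) = block_matrix (transpose P) (transpose R) (transpose Q) (transpose S)"
  by (simp add: vec_eq_iff transpose_def block_matrix_def split: sum.split)

lemma block_matrix_lower_right:
  fixes d :: real and w :: "real ^ ('n::finite + 'm::finite)"
  shows "v \<bullet> (block_matrix 0 0 0 (d *\<^sub>R mat 1) *v w) = d * (lower v \<bullet> lower w)"
    and "upper (block_matrix 0 0 0 (d *\<^sub>R mat 1) *v w) = 0"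
    and "lower (block_matrix 0 0 0 (d *\<^sub>R mat 1) *v w) = d *\<^sub>R lower w"
  by (simp_all add: inner_upper_lower upper_block_matrix lower_block_matrix
      scaleR_matrix_vector_assoc[symmetric])

section \<open>The spectral norm of \<open>E\<close> and the symmetry of the diagonal block\<close>

lemma norm_le_spectral_norm: "norm (A *v v) \<le> spectral_norm A * norm v"
  for A :: "real ^ 'n ^ 'm"
  unfolding spectral_norm_def by (intro onorm matrix_vector_mul_bounded_linear)

lemma spectral_norm_lower_right:
  "spectral_norm (block_matrix 0 0 0 (d *\<^sub>R mat 1) :: real ^ ('n::finite + 'm::finite) ^ ('n + 'm)) = \<bar>d\<bar>"
  (is "spectral_norm ?E = _")
proof (rule antisym)
  have "norm (?E *v w) \<le> \<bar>d\<bar> * norm w" for w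
  proof (rule power2_le_imp_le)
    have "(norm (?E *v w))\<^sup>2 = d\<^sup>2 * (norm (lower w))\<^sup>2"
      unfolding norm_upper_lower[of "?E *v w"] block_matrix_lower_right by (simp add: power_mult_distrib)
    also have "\<dots> \<le> d\<^sup>2 * (norm w)\<^sup>2"
      by (intro mult_left_mono) (simp_all add: norm_upper_lower[of w])
    finally show "(norm (?E *v w))\<^sup>2 \<le> (\<bar>d\<bar> * norm w)\<^sup>2"
      by (simp add: power_mult_distrib)
  qed simp
  then show "spectral_norm ?E \<le> \<bar>d\<bar>"
    unfolding spectral_norm_def by (intro onorm_le)
next
  \<comment> \<open>Types are inhabited, so the lower block has a coordinate \<open>l\<close>. The
    unit vector along it has Rayleigh quotient \<open>d\<close>, and Cauchy-Schwarz turns this into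
    a lower bound for the norm.\<close>
  obtain l :: 'm where True
    by simp
  let ?a = "axis (Inr l) 1 :: real ^ ('n::finite + 'm::finite)"
  have "\<bar>?a \<bullet> (?E *v ?a)\<bar> \<le> norm ?a * norm (?E *v ?a)"
    by (rule Cauchy_Schwarz_ineq2)
  also have "?a \<bullet> (?E *v ?a) = d"
  proof -
    have "lower ?a = axis l 1"
      by (simp add: vec_eq_iff lower_def axis_def)
    then show ?thesis
      by (simp add: block_matrix_lower_right inner_axis)
  qed
  finally show "\<bar>d\<bar> \<le> spectral_norm ?E"
    using norm_le_spectral_norm[of ?E ?a] by simp
qed

lemma diag_matrix_mult: "diag_matrix a ** diag_matrix b = diag_matrix (\<chi> j. a $ j * b $ j)"
  for a b :: "'a::semiring_1 ^ 'n"
proof -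
  have "(\<Sum>k\<in>UNIV. diag_matrix a $ i $ k * diag_matrix b $ k $ j)
      = (\<Sum>k\<in>UNIV. if k = i then a $ i * diag_matrix b $ i $ j else 0)" for i j
    by (intro sum.cong) (auto simp: diag_matrix_def)
  then show ?thesis
    by (simp add: vec_eq_iff matrix_matrix_mult_def) (simp add: diag_matrix_def)
qed

lemma transpose_matrix_inv_diag:
  fixes d :: "real ^ 'n"
  assumes d: "\<forall>j. d $ j \<noteq> 0"
  shows "transpose (matrix_inv (diag_matrix d)) = matrix_inv (diag_matrix d)"
proof -
  let ?D = "diag_matrix d" and ?D' = "diag_matrix (\<chi> j. inverse (d $ j))"
  have "?D ** ?D' = mat 1" "?D' ** ?D = mat 1"
    unfolding diag_matrix_mult using d by (simp_all add: vec_eq_iff diag_matrix_def mat_def)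
  \<comment> \<open>\<open>matrix_inv\<close> is a Hilbert choice, so its defining property must
    first be shown satisfiable; uniqueness of inverses then identifies it with the diagonal
    \<open>?D'\<close>.\<close>
  then have "\<exists>B. ?D ** B = mat 1 \<and> B ** ?D = mat 1"
    by blast
  then have inv: "?D ** matrix_inv ?D = mat 1 \<and> matrix_inv ?D ** ?D = mat 1"
    unfolding matrix_inv_def by (rule someI_ex)
  have "matrix_inv ?D = ?D'"
    by (metis inv \<open>?D' ** ?D = mat 1\<close> matrix_mul_assoc matrix_mul_lid matrix_mul_rid)
  also have "transpose ?D' = ?D'"
    by (simp add: vec_eq_iff transpose_def diag_matrix_def)
  finally show ?thesis
    using \<open>matrix_inv ?D = ?D'\<close> by simp
qed

section \<open>The lower part of an eigenvector and the two estimates along the segment\<close>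

text \<open>Here \<open>c\<close> bounds from below the distance of the eigenvalue \<open>l\<close>
  from the shift \<open>t * d\<close>; with \<open>c = \<bar>\<lambda>\<^sub>i\<bar> - 2
  \<parallel>E\<parallel>\<close> the right side becomes
  \<open>\<phi>\<^sub>i\<^sup>2\<close>.\<close>

lemma lower_part_bound:
  fixes P :: "real ^ 'n ^ 'n" and A :: "real ^ 'n ^ 'm" and w :: "real ^ ('n + 'm)"
  assumes eig: "(block_matrix P Q A 0 + t *\<^sub>R block_matrix 0 0 0 (d *\<^sub>R mat 1)) *v w = l *\<^sub>R w"
    and w: "norm w = 1" and c: "0 < c" "c \<le> \<bar>l - t * d\<bar>"
  shows "(norm (lower w))\<^sup>2 \<le> (spectral_norm A / sqrt (c\<^sup>2 + (spectral_norm A)\<^sup>2))\<^sup>2"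
proof -
  let ?a = "spectral_norm A" and ?p = "(norm (lower w))\<^sup>2"
  have "lower ((block_matrix P Q A 0 + t *\<^sub>R block_matrix 0 0 0 (d *\<^sub>R mat 1)) *v w)
      = A *v upper w + (t * d) *\<^sub>R lower w"
    using lower_block_matrix[of P Q A 0 w] block_matrix_lower_right(3)[of d w]
    by (simp add: matrix_vector_mult_add_rdistrib scaleR_matrix_vector_assoc[symmetric] vec_eq_iff lower_def)
  moreover have "lower (l *\<^sub>R w) = l *\<^sub>R lower w"
    by (simp add: vec_eq_iff lower_def)
  ultimately have "(l - t * d) *\<^sub>R lower w = A *v upper w"
    unfolding eig by (simp add: algebra_simps)
  then have "\<bar>l - t * d\<bar> * norm (lower w) \<le> ?a * norm (upper w)"
    using norm_le_spectral_norm[of A "upper w"] by (metis norm_scaleR)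
  then have "c * norm (lower w) \<le> ?a * norm (upper w)"
    using mult_right_mono[OF c(2), of "norm (lower w)"] by simp
  then have "(c * norm (lower w))\<^sup>2 \<le> (?a * norm (upper w))\<^sup>2"
    using c by (intro power_mono) auto
  also have "(norm (upper w))\<^sup>2 = 1 - ?p"
    using norm_upper_lower[of w] w by simp
  then have "(?a * norm (upper w))\<^sup>2 = ?a\<^sup>2 * (1 - ?p)"
    by (simp add: power_mult_distrib)
  finally have "?p * (c\<^sup>2 + ?a\<^sup>2) \<le> ?a\<^sup>2"
    by (simp add: power_mult_distrib algebra_simps)
  \<comment> \<open>Positivity of \<open>c\<close> keeps the denominator nonzero even for
    \<open>A = 0\<close>.\<close>
  moreover have "c\<^sup>2 + ?a\<^sup>2 > 0"
    using c by (simp add: add_pos_nonneg)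
  ultimately show ?thesis
    by (simp add: power_divide pos_le_divide_eq)
qed

theorem theorem2p1:
  fixes x z :: "real ^ 'n"
    and A :: "real ^ 'n ^ 'm"
    and \<Theta> :: "real ^ 'n ^ 'n"
    and N :: "'n set"
    and reg_thr :: real
    and M E :: "real ^ ('n + 'm) ^ ('n + 'm)"
    and \<phi> :: "nat \<Rightarrow> real"
    and i :: nat
  assumes "CARD('m) \<le> CARD('n)"
    and "\<forall>j. x $ j > 0"
    and "\<forall>j. z $ j > 0"
    and \<Theta>_eq: "\<Theta> = diag_matrix (\<chi> j. x $ j / z $ j)"
    and "reg_thr > 0"
    and "N \<noteq> {}"
    and "(MAX j\<in>N. \<Theta> $ j $ j) * row_sum_norm (A ** transpose A) \<le> reg_thr"
    and M_eq: "M = block_matrix (- matrix_inv \<Theta>) (transpose A) A 0"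
    and E_eq: "E = block_matrix 0 0 0 (delta_d N \<Theta> A *\<^sub>R mat 1)"
    and \<phi>_eq: "\<And>k. \<phi> k = spectral_norm A /
           sqrt ((\<bar>eigenvalue k M\<bar> - 2 * spectral_norm E)\<^sup>2 + (spectral_norm A)\<^sup>2)"
    and "i \<in> {1..CARD('n + 'm)}"
    and "\<bar>eigenvalue i M\<bar> > 2 * spectral_norm E"
    and "\<forall>t\<in>{0..1}. simple_eigenvalue (M + t *\<^sub>R E) (eigenvalue i (M + t *\<^sub>R E))"
  shows "\<bar>eigenvalue i M - eigenvalue i (M + E)\<bar> \<le> spectral_norm E * (\<phi> i)\<^sup>2"
proof -
  define \<delta> where "\<delta> = delta_d N \<Theta> A"
  define f where "f t = eigenvalue i (M + t *\<^sub>R E)" for t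
  have E: "E = block_matrix 0 0 0 (\<delta> *\<^sub>R mat 1)"
    by (simp add: E_eq \<delta>_def)
  have norm_E: "spectral_norm E = \<bar>\<delta>\<bar>"
    by (simp add: E spectral_norm_lower_right)
  \<comment> \<open>Eigenvalues are numbered from 1, list positions from 0.\<close>
  have i: "i - 1 < CARD('n + 'm)"
    using \<open>i \<in> _\<close> by auto
  have "transpose (matrix_inv \<Theta>) = matrix_inv \<Theta>"
    unfolding \<Theta>_eq using assms(2,3) by (intro transpose_matrix_inv_diag) (auto simp: less_imp_neq[symmetric])
  then have sym_M: "transpose M = M"
    unfolding M_eq transpose_block_matrix
    by (simp add: transpose_def vec_eq_iff block_matrix_def split: sum.split)
  have sym_E: "transpose E = E"
    unfolding E transpose_block_matrix by (simp add: transpose_def vec_eq_iff mat_def block_matrix_def split: sum.split)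
  have inner_E: "\<bar>w \<bullet> (E *v w)\<bar> = \<bar>\<delta>\<bar> * (norm (lower w))\<^sup>2" for w
    by (simp add: E block_matrix_lower_right abs_mult power2_norm_eq_inner)
  \<comment> \<open>First use of the line bound, with the crude constant
    \<open>\<bar>\<delta>\<bar>\<close>: the lower part of a unit vector has norm at most 1.\<close>
  have weyl: "\<bar>f t - f 0\<bar> \<le> \<bar>\<delta>\<bar> * t" if "t \<ge> 0" for t
  proof -
    have "\<bar>w \<bullet> (E *v w)\<bar> \<le> \<bar>\<delta>\<bar>" if "norm w = 1" for w
    proof -
      have "(norm (lower w))\<^sup>2 \<le> 1"
        using norm_upper_lower[of w] zero_le_power2[of "norm (upper w)"] unfolding that power_one by linarith
      then show ?thesis
        unfolding inner_E by (intro mult_left_le) auto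
    qed
    then have "\<bar>f t - f 0\<bar> \<le> \<bar>\<delta>\<bar> * (t - 0)"
      unfolding f_def eigenvalue_def by (intro eigenvalue_line_bound[OF sym_M sym_E i \<open>t \<ge> 0\<close>])
    then show ?thesis
      by simp
  qed
  have "\<bar>w \<bullet> (E *v w)\<bar> \<le> \<bar>\<delta>\<bar> * (\<phi> i)\<^sup>2"
    if t: "0 \<le> t" "t \<le> 1" and w: "norm w = 1" "(M + t *\<^sub>R E) *v w = f t *\<^sub>R w" for t w
  proof -
    \<comment> \<open>Origin of the 2 in \<open>\<phi>\<close>: one norm of \<open>E\<close> pays
      for the motion from \<open>f 0\<close> to \<open>f t\<close>, the other for the shift
      \<open>t * \<delta>\<close>.\<close>
    have "\<bar>\<delta>\<bar> * t \<le> \<bar>\<delta>\<bar>" "\<bar>t * \<delta>\<bar> \<le> \<bar>\<delta>\<bar>"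
      using t by (auto simp: abs_mult mult_left_le mult_left_le_one_le)
    then have "\<bar>f 0\<bar> - 2 * \<bar>\<delta>\<bar> \<le> \<bar>f t - t * \<delta>\<bar>"
      using weyl[OF t(1)] by linarith
    moreover have "0 < \<bar>f 0\<bar> - 2 * \<bar>\<delta>\<bar>"
      using assms(12) by (simp add: f_def norm_E)
    ultimately have "(norm (lower w))\<^sup>2 \<le> (\<phi> i)\<^sup>2"
      using lower_part_bound[OF w(2)[unfolded M_eq E] w(1)]
      by (simp add: \<phi>_eq norm_E f_def)
    then show ?thesis
      by (simp add: inner_E mult_left_mono)
  qed
  \<comment> \<open>Second use of the line bound, on \<open>[0, 1]\<close> with the sharper
    constant; \<open>1 - 0\<close> is kept to match the interval length
    \<open>b - a\<close>.\<close>
  then have "\<bar>f 1 - f 0\<bar> \<le> \<bar>\<delta>\<bar> * (\<phi> i)\<^sup>2 * (1 - 0)"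
    unfolding f_def eigenvalue_def
    by (intro eigenvalue_line_bound[OF sym_M sym_E i]) (auto simp: f_def eigenvalue_def)
  then show ?thesis
    by (simp add: f_def norm_E abs_minus_commute)
qed

end
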